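(* A completely regular frame $L$ is perfectly regular if and only if every open sublocale of $L$ is the interior of its coz-closure; that is, $\mathfrak{o}(a)=\operatorname{int}\left(\overline{\mathfrak{o}(a)}^{\,coz}\right)$ for each $a\in L$.
   Context: An element $a$ of a frame $L$ is a cozero element if $a=h(\mathbb{R}\setminus\{0\})$ for some frame homomorphism $h:\mathfrak{O}\mathbb{R}\to L$; $\mathrm{Coz}\,L$ is the set of cozero elements of $L$. A frame $L$ is completely regular iff every element of $L$ is a join of cozero elements; it is perfectly regular if every element is a join of cozero elements and every element is a meet of cozero elements. A sublocale of $L$ is a subset $S\subseteq L$ closed under arbitrary meets such that $x\to s\in S$ for all $x\in L$, $s\in S$, where $\to$ is the Heyting implication of $L$; sublocales are ordered by inclusion, and intersections of sublocales are sublocales. For $a\in L$, the open sublocale associated with $a$ is $\mathfrak{o}(a)=\{a\to x\mid x\in L\}$. The interior $\operatorname{int}(S)$ of a sublocale $S$ is the largest open sublocale contained in $S$. The coz-closure of a sublocale $S$ of $L$ is $\overline{S}^{\,coz}=\bigcap\{\mathfrak{o}(b)\mid b\in\mathrm{Coz}\,L,\ S\subseteq\mathfrak{o}(b)\}$. *)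

theory Defs
  imports Complex_Main
begin

text \<open>A frame is a whole type here. The library class
  \<^class>\<open>complete_distrib_lattice\<close> is not suitable, since it demands complete distributivity.\<close>

class frame = complete_lattice +
  assumes inf_Sup_frame: "inf a (Sup B) = (SUP b\<in>B. inf a b)"

definition himp :: "'a::frame \<Rightarrow> 'a \<Rightarrow> 'a"
  where "himp a b = Sup {x. inf x a \<le> b}"

lemma le_himp_iff: "x \<le> himp a b \<longleftrightarrow> inf x a \<le> b"
proof
  have "inf (himp a b) a = (SUP x\<in>{x. inf x a \<le> b}. inf a x)"
    unfolding himp_def by (subst inf_commute) (rule inf_Sup_frame)
  also have "\<dots> \<le> b"
    by (rule SUP_least) (simp add: inf_commute)
  finally have *: "inf (himp a b) a \<le> b" .
  assume "x \<le> himp a b"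
  then have "inf x a \<le> inf (himp a b) a" by (rule inf_mono) simp
  with * show "inf x a \<le> b" by (rule order_trans[rotated])
next
  assume "inf x a \<le> b"
  then show "x \<le> himp a b" unfolding himp_def by (intro Sup_upper) simp
qed

text \<open>Frame homomorphisms from the frame of open sets of a space into a frame. Such a map is
  represented by a function on all sets of points, of which only the values on open sets matter.\<close>

definition opens_frame_hom :: "('t::topological_space set \<Rightarrow> 'a::frame) \<Rightarrow> bool"
  where "opens_frame_hom h \<longleftrightarrow>
    h UNIV = top \<and>
    (\<forall>U V. open U \<longrightarrow> open V \<longrightarrow> h (U \<inter> V) = inf (h U) (h V)) \<and>
    (\<forall>\<U>. (\<forall>U\<in>\<U>. open U) \<longrightarrow> h (\<Union>\<U>) = Sup (h ` \<U>))"

definition Coz :: "'a::frame set"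
  where "Coz = {h (UNIV - {0}) | h :: real set \<Rightarrow> 'a. opens_frame_hom h}"

definition completely_regular :: "'a::frame itself \<Rightarrow> bool"
  where "completely_regular TYPE('a) \<longleftrightarrow> (\<forall>a::'a. \<exists>C\<subseteq>Coz. a = Sup C)"

definition perfectly_regular :: "'a::frame itself \<Rightarrow> bool"
  where "perfectly_regular TYPE('a) \<longleftrightarrow>
    (\<forall>a::'a. (\<exists>C\<subseteq>Coz. a = Sup C) \<and> (\<exists>C\<subseteq>Coz. a = Inf C))"

definition is_sublocale :: "'a::frame set \<Rightarrow> bool"
  where "is_sublocale S \<longleftrightarrow> (\<forall>A\<subseteq>S. Inf A \<in> S) \<and> (\<forall>x. \<forall>s\<in>S. himp x s \<in> S)"

definition open_sublocale :: "'a::frame \<Rightarrow> 'a set"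
  where "open_sublocale a = {himp a x | x. True}"

definition sublocale_interior :: "'a::frame set \<Rightarrow> 'a set"
  where "sublocale_interior S = (GREATEST T. T \<in> range open_sublocale \<and> T \<subseteq> S)"

definition coz_closure :: "'a::frame set \<Rightarrow> 'a set"
  where "coz_closure S = \<Inter>{open_sublocale b | b. b \<in> Coz \<and> S \<subseteq> open_sublocale b}"

lemma himp_himp: "himp a (himp b x) = himp (inf a b) x"
  by (rule order.antisym)
    (metis le_himp_iff inf_assoc order_refl, metis le_himp_iff inf_assoc order_refl)

lemma is_sublocale_open_sublocale: "is_sublocale (open_sublocale a)"
proof -
  have "Inf A \<in> open_sublocale a" if A: "A \<subseteq> open_sublocale a" for A
  proof -
    have fixed: "himp a y = y" if "y \<in> A" for y
      using that A by (auto simp: open_sublocale_def himp_himp)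
    have "himp a (Inf A) = Inf A"
    proof (rule order.antisym)
      show "himp a (Inf A) \<le> Inf A"
      proof (rule Inf_greatest)
        fix y assume y: "y \<in> A"
        have "inf (himp a (Inf A)) a \<le> y"
          by (rule order_trans[OF _ Inf_lower[OF y]]) (simp flip: le_himp_iff)
        then show "himp a (Inf A) \<le> y" by (simp add: fixed[OF y] flip: le_himp_iff)
      qed
    qed (simp add: le_himp_iff)
    then show ?thesis unfolding open_sublocale_def by (metis (mono_tags) mem_Collect_eq)
  qed
  moreover have "himp x s \<in> open_sublocale a" if "s \<in> open_sublocale a" for x s
    using that unfolding open_sublocale_def by (auto simp: himp_himp) (metis himp_himp inf_commute)
  ultimately show ?thesis unfolding is_sublocale_def by blast
qed

lemma is_sublocale_coz_closure: "is_sublocale (coz_closure S)"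
proof -
  have "is_sublocale T" if "T \<in> {open_sublocale b | b. b \<in> Coz \<and> S \<subseteq> open_sublocale b}" for T
    using that is_sublocale_open_sublocale by auto
  then show ?thesis unfolding coz_closure_def is_sublocale_def by (meson Inter_iff Inter_lower subset_trans)
qed

lemma open_sublocale_mono:
  assumes "a \<le> b" shows "open_sublocale a \<subseteq> open_sublocale b"
proof -
  have "himp a x = himp b (himp a x)" for x
    using assms by (simp add: himp_himp inf_absorb2)
  then show ?thesis unfolding open_sublocale_def by blast
qed

text \<open>Every sublocale contains a largest open sublocale, so that \<^const>\<open>Greatest\<close> in
  \<^const>\<open>sublocale_interior\<close> is well defined.\<close>

lemma sublocale_interior:
  assumes "is_sublocale S"
  shows "sublocale_interior S \<in> range open_sublocale" (is ?R)
    and "sublocale_interior S \<subseteq> S" (is ?S)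
    and "\<And>a. open_sublocale a \<subseteq> S \<Longrightarrow> open_sublocale a \<subseteq> sublocale_interior S"
proof -
  let ?A = "{a. open_sublocale a \<subseteq> S}"
  have sub: "open_sublocale (Sup ?A) \<subseteq> S"
  proof
    fix y assume "y \<in> open_sublocale (Sup ?A)"
    then obtain x where y: "y = himp (Sup ?A) x" unfolding open_sublocale_def by blast
    have "himp (Sup ?A) x = (INF a\<in>?A. himp a x)"
    proof (rule order.antisym)
      show "himp (Sup ?A) x \<le> (INF a\<in>?A. himp a x)"
      proof (rule INF_greatest)
        fix a assume "a \<in> ?A"
        then have "inf (himp (Sup ?A) x) a \<le> inf (himp (Sup ?A) x) (Sup ?A)"
          by (intro inf_mono Sup_upper) simp_all
        also have "\<dots> \<le> x" by (simp flip: le_himp_iff)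
        finally show "himp (Sup ?A) x \<le> himp a x" by (simp add: le_himp_iff)
      qed
      have "inf (INF a\<in>?A. himp a x) b \<le> x" if "b \<in> ?A" for b
        using INF_lower[OF that, of "\<lambda>a. himp a x"] by (simp add: le_himp_iff)
      then show "(INF a\<in>?A. himp a x) \<le> himp (Sup ?A) x"
        unfolding le_himp_iff inf_Sup_frame by (rule SUP_least)
    qed
    moreover have "(\<lambda>a. himp a x) ` ?A \<subseteq> S" unfolding open_sublocale_def by auto
    ultimately show "y \<in> S" using assms unfolding y is_sublocale_def by auto
  qed
  have eq: "sublocale_interior S = open_sublocale (Sup ?A)"
    unfolding sublocale_interior_def
  proof (rule Greatest_equality)
    fix T assume "T \<in> range open_sublocale \<and> T \<subseteq> S"
    then obtain a where "T = open_sublocale a" "a \<in> ?A" by blast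
    then show "T \<subseteq> open_sublocale (Sup ?A)" by (simp only: open_sublocale_mono Sup_upper)
  qed (use sub in blast)
  show ?R ?S unfolding eq using sub by auto
  show "open_sublocale a \<subseteq> sublocale_interior S" if "open_sublocale a \<subseteq> S" for a
    unfolding eq using that by (intro open_sublocale_mono Sup_upper) simp
qed

end

theory Submission
  imports Defs
begin

text \<open>The map \<open>a \<mapsto> open_sublocale a\<close> is an order embedding. Hence the interior of the
  coz-closure of \<open>open_sublocale a\<close> is the open sublocale of the meet of all cozero elements
  above \<open>a\<close>, and it equals \<open>open_sublocale a\<close> iff \<open>a\<close> is a meet of cozero elements.\<close>

text \<open>Test the inclusion on the single element \<open>himp a b\<close>: members of
  \<open>open_sublocale b\<close> are fixed by \<open>himp b\<close>, and \<open>himp b\<close>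
  sends \<open>himp a b\<close> to \<open>top\<close>, so \<open>himp a b\<close> is
  \<open>top\<close>.\<close>

lemma open_sublocale_subset_iff: "open_sublocale a \<subseteq> open_sublocale b \<longleftrightarrow> a \<le> b"
proof
  assume "open_sublocale a \<subseteq> open_sublocale b"
  then have "himp a b \<in> open_sublocale b" unfolding open_sublocale_def by blast
  then obtain x where x: "himp a b = himp b x" unfolding open_sublocale_def by blast
  then have "himp b (himp a b) = himp a b" by (simp only: x himp_himp inf_idem)
  \<comment> \<open>The double implication collapses to \<open>himp (inf b a) b\<close>, and
    \<open>inf b a\<close> lies below \<open>b\<close>.\<close>
  moreover have "top \<le> himp b (himp a b)" by (simp add: himp_himp le_himp_iff del: top_le)
  ultimately show "a \<le> b" by (metis le_himp_iff inf_top_left)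
qed (rule open_sublocale_mono)

lemma open_sublocale_eq_iff: "open_sublocale a = open_sublocale b \<longleftrightarrow> a = b"
  by (simp add: set_eq_subset open_sublocale_subset_iff order.eq_iff)

text \<open>The interior depends only on the open sublocales inside the coz-closure. Lying in an
  intersection means lying in each member, which the order embedding turns into being a lower
  bound.\<close>

lemma open_sublocale_subset_coz_closure_iff:
  "open_sublocale c \<subseteq> coz_closure (open_sublocale a) \<longleftrightarrow> c \<le> Inf {b \<in> Coz. a \<le> b}"
proof -
  have "open_sublocale c \<subseteq> coz_closure (open_sublocale a) \<longleftrightarrow>
      (\<forall>b\<in>Coz. open_sublocale a \<subseteq> open_sublocale b \<longrightarrow> open_sublocale c \<subseteq> open_sublocale b)"
    unfolding coz_closure_def by blast
  then show ?thesis by (auto simp: open_sublocale_subset_iff le_Inf_iff)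
qed

lemma sublocale_interior_coz_closure:
  "sublocale_interior (coz_closure (open_sublocale a)) = open_sublocale (Inf {b \<in> Coz. a \<le> b})"
  unfolding sublocale_interior_def
proof (rule Greatest_equality)
  fix T assume "T \<in> range open_sublocale \<and> T \<subseteq> coz_closure (open_sublocale a)"
  then obtain c where "T = open_sublocale c" "open_sublocale c \<subseteq> coz_closure (open_sublocale a)"
    by blast
  then show "T \<subseteq> open_sublocale (Inf {b \<in> Coz. a \<le> b})"
    by (simp only: open_sublocale_subset_coz_closure_iff open_sublocale_subset_iff)
\<comment> \<open>Keeping the meet folded leaves an instance of reflexivity.\<close>
qed (simp add: open_sublocale_subset_coz_closure_iff del: le_Inf_iff)

text \<open>Any \<open>C\<close> with meet \<open>a\<close> consists of upper bounds of
  \<open>a\<close>, so the set of all upper bounds in \<open>B\<close> is the largest candidate and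
  already has meet \<open>a\<close>.\<close>

lemma Inf_upper_bounds_eq_iff:
  fixes a :: "'a::complete_lattice"
  shows "a = Inf {b \<in> B. a \<le> b} \<longleftrightarrow> (\<exists>C\<subseteq>B. a = Inf C)"
proof
  assume "\<exists>C\<subseteq>B. a = Inf C"
  then obtain C where C: "C \<subseteq> B" "a = Inf C" by blast
  then have "C \<subseteq> {b \<in> B. a \<le> b}" by (auto intro: Inf_lower)
  then have "Inf {b \<in> B. a \<le> b} \<le> a" unfolding C(2) by (rule Inf_superset_mono)
  then show "a = Inf {b \<in> B. a \<le> b}" by (auto intro!: order.antisym Inf_greatest)
qed (rule exI[of _ "{b \<in> B. a \<le> b}"], blast)

theorem corollary4p6:
  assumes "completely_regular TYPE('a::frame)"
  shows "perfectly_regular TYPE('a) \<longleftrightarrow>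
    (\<forall>a::'a. open_sublocale a = sublocale_interior (coz_closure (open_sublocale a)))"
  \<comment> \<open>Complete regularity supplies the join half of perfect regularity, so only the
    meet half remains to be matched.\<close>
  using assms
  by (simp add: perfectly_regular_def completely_regular_def sublocale_interior_coz_closure
      open_sublocale_eq_iff Inf_upper_bounds_eq_iff)

end
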